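(* Let $\alpha,\beta\in\mathbb{K}^*$ be roots of unity with $\alpha\beta\neq1$, and let $\underline{\mu}=(\mu_1,\mu_2,\mu_3)\in(\mathbb{K}^* )^3$. Then the module $\mathscr{V}_2(\underline{\mu})$ is a simple $M_2(\alpha,\beta)$-module of dimension $l_1l_2$ over $\mathbb{K}$.
   Context: $\mathbb{K}$ is an algebraically closed field of arbitrary characteristic and $\mathbb{K}^*=\mathbb{K}\setminus\{0\}$; all modules are right modules. For a root of unity $\xi\in\mathbb{K}^*$, $\operatorname{ord}(\xi)$ is its order in the group $\mathbb{K}^*$. For $\alpha,\beta\in\mathbb{K}^*$, the two-parameter quantum matrix algebra $M_2(\alpha,\beta)$ is the associative unital $\mathbb{K}$-algebra generated by $X_{11},X_{12},X_{21},X_{22}$ subject to the relations $X_{12}X_{11}=\alpha X_{11}X_{12}$, $X_{22}X_{21}=\alpha X_{21}X_{22}$, $X_{21}X_{11}=\beta X_{11}X_{21}$, $X_{22}X_{12}=\beta X_{12}X_{22}$, $X_{21}X_{12}=\beta\alpha^{-1}X_{12}X_{21}$, $X_{22}X_{11}-X_{11}X_{22}=(\beta-\alpha^{-1})X_{12}X_{21}$. Set $l_1:=\operatorname{ord}(\alpha\beta)$ if $\operatorname{ord}(\beta)\mid\operatorname{ord}(\alpha\beta)\operatorname{ord}(\alpha\beta^{-1})$ and $l_1:=2\operatorname{ord}(\alpha\beta)$ otherwise; set $l_2:=\operatorname{ord}(\alpha\beta^{-1})$. $\mathscr{V}_2(\underline{\mu})$ is the $\mathbb{K}$-vector space with basis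 $\{e(a,b):0\le a\le l_1-1,\ 0\le b\le l_2-1\}$ and $M_2(\alpha,\beta)$-action (which does define a module structure) $$e(a,b)X_{11}=\begin{cases}\mu_1^{-1}\mu_3\alpha^{-1}(\alpha^{-1}\beta)^b[(\alpha\beta)^a-1]e(a-1,b)& a\neq0\\ 0& a=0\end{cases}$$ $$e(a,b)X_{12}=\mu_2^{-1}\mu_3\beta^a(\alpha^{-1}\beta)^be(a,b\dotplus(-1)),\qquad e(a,b)X_{21}=\mu_2\alpha^ae(a,b\dotplus1),$$ $$e(a,b)X_{22}=\begin{cases}\mu_1e(a+1,b)& a\neq l_1-1\\ \mu_1\alpha^{-bl_1}e(0,b)& a=l_1-1\end{cases}$$ where $\dotplus$ is addition modulo $l_2$. *)

theory Defs
  imports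
    "HOL-Library.Poly_Mapping"
    "HOL-Algebra.QuotRing"
    "HOL-Algebra.Multiplicative_Group"
    "HOL-Algebra.Algebraic_Closure_Type"
begin

section \<open>Right modules\<close>

text \<open>The library's modules are left modules over commutative rings. As there, the fields
  \<open>mult\<close> and \<open>one\<close> inherited from \<open>ring\<close> play no role in the underlying abelian group.\<close>

record ('r, 'm) right_module = "'m ring" +
  ract :: "'m \<Rightarrow> 'r \<Rightarrow> 'm" (infixl "\<cdot>\<index>" 70)

locale right_module = R?: ring R + M?: abelian_group M
  for R :: "('r, 'a) ring_scheme" (structure) and M :: "('r, 'm, 'x) right_module_scheme" (structure) +
  assumes ract_closed:
      "\<lbrakk>v \<in> carrier M; r \<in> carrier R\<rbrakk> \<Longrightarrow> v \<cdot>\<^bsub>M\<^esub> r \<in> carrier M"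
    and ract_add_ring:
      "\<lbrakk>v \<in> carrier M; r \<in> carrier R; s \<in> carrier R\<rbrakk> \<Longrightarrow>
        v \<cdot>\<^bsub>M\<^esub> (r \<oplus>\<^bsub>R\<^esub> s) = v \<cdot>\<^bsub>M\<^esub> r \<oplus>\<^bsub>M\<^esub> v \<cdot>\<^bsub>M\<^esub> s"
    and ract_add_mod:
      "\<lbrakk>v \<in> carrier M; w \<in> carrier M; r \<in> carrier R\<rbrakk> \<Longrightarrow>
        (v \<oplus>\<^bsub>M\<^esub> w) \<cdot>\<^bsub>M\<^esub> r = v \<cdot>\<^bsub>M\<^esub> r \<oplus>\<^bsub>M\<^esub> w \<cdot>\<^bsub>M\<^esub> r"
    and ract_mult:
      "\<lbrakk>v \<in> carrier M; r \<in> carrier R; s \<in> carrier R\<rbrakk> \<Longrightarrow>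
        v \<cdot>\<^bsub>M\<^esub> (r \<otimes>\<^bsub>R\<^esub> s) = (v \<cdot>\<^bsub>M\<^esub> r) \<cdot>\<^bsub>M\<^esub> s"
    and ract_one:
      "v \<in> carrier M \<Longrightarrow> v \<cdot>\<^bsub>M\<^esub> \<one>\<^bsub>R\<^esub> = v"

definition right_submodule ::
    "'m set \<Rightarrow> ('r, 'a) ring_scheme \<Rightarrow> ('r, 'm, 'x) right_module_scheme \<Rightarrow> bool" where
  "right_submodule N R M \<longleftrightarrow>
     additive_subgroup N M \<and> (\<forall>v\<in>N. \<forall>r\<in>carrier R. v \<cdot>\<^bsub>M\<^esub> r \<in> N)"

locale simple_right_module = right_module +
  assumes nonzero: "carrier M \<noteq> {\<zero>\<^bsub>M\<^esub>}"
    and submodule_trivial: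
      "right_submodule N R M \<Longrightarrow> N = {\<zero>\<^bsub>M\<^esub>} \<or> N = carrier M"

section \<open>Vector spaces of finite formal linear combinations\<close>

definition vscale :: "'k \<Rightarrow> ('x \<Rightarrow>\<^sub>0 'k) \<Rightarrow> ('x \<Rightarrow>\<^sub>0 'k::field)" where
  "vscale c v = Poly_Mapping.map ((*) c) v"

lemma lookup_vscale: "Poly_Mapping.lookup (vscale c v) x = c * Poly_Mapping.lookup v x"
  by (simp add: vscale_def Poly_Mapping.map.rep_eq when_def)

lemma vector_space_vscale: "vector_space (vscale :: 'k::field \<Rightarrow> _)"
  by unfold_locales (auto intro!: poly_mapping_eqI simp: lookup_vscale lookup_add algebra_simps)

text \<open>The linear extension of a map defined on the basis.\<close>

definition lin_ext :: "('x \<Rightarrow> 'y \<Rightarrow>\<^sub>0 'k) \<Rightarrow> ('x \<Rightarrow>\<^sub>0 'k) \<Rightarrow> ('y \<Rightarrow>\<^sub>0 'k::field)" where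
  "lin_ext f v = (\<Sum>x\<in>Poly_Mapping.keys v. vscale (Poly_Mapping.lookup v x) (f x))"

section \<open>The free algebra on four generators\<close>

text \<open>Words form the free monoid. It is written additively because the product of
  \<open>poly_mapping\<close> is the convolution over an additive (here noncommutative) monoid.\<close>

instantiation list :: (type) monoid_add
begin
definition zero_list :: "'a list" where "zero_list = []"
definition plus_list :: "'a list \<Rightarrow> 'a list \<Rightarrow> 'a list" where "plus_list = (@)"
instance by standard (simp_all add: zero_list_def plus_list_def)
end

datatype gen = X11 | X12 | X21 | X22

type_synonym 'k free_alg = "gen list \<Rightarrow>\<^sub>0 'k"

definition gvar :: "gen \<Rightarrow> 'k::field free_alg" where
  "gvar g = Poly_Mapping.single [g] 1"

definition scalar :: "'k \<Rightarrow> 'k::field free_alg" where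
  "scalar c = Poly_Mapping.single [] c"

section \<open>The two-parameter quantum matrix algebra\<close>

definition M2_relators :: "'k \<Rightarrow> 'k \<Rightarrow> 'k::field free_alg set" where
  "M2_relators \<alpha> \<beta> =
    {gvar X12 * gvar X11 - scalar \<alpha> * (gvar X11 * gvar X12),
     gvar X22 * gvar X21 - scalar \<alpha> * (gvar X21 * gvar X22),
     gvar X21 * gvar X11 - scalar \<beta> * (gvar X11 * gvar X21),
     gvar X22 * gvar X12 - scalar \<beta> * (gvar X12 * gvar X22),
     gvar X21 * gvar X12 - scalar (\<beta> * inverse \<alpha>) * (gvar X12 * gvar X21),
     gvar X22 * gvar X11 - gvar X11 * gvar X22 - scalar (\<beta> - inverse \<alpha>) * (gvar X12 * gvar X21)}"

definition M2_ideal :: "'k \<Rightarrow> 'k \<Rightarrow> 'k::field free_alg set" where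
  "M2_ideal \<alpha> \<beta> = Idl\<^bsub>ring_of_type_algebra\<^esub> (M2_relators \<alpha> \<beta>)"

definition M2 :: "'k \<Rightarrow> 'k \<Rightarrow> 'k::field free_alg set ring" where
  "M2 \<alpha> \<beta> = ring_of_type_algebra Quot M2_ideal \<alpha> \<beta>"

definition M2_class :: "'k \<Rightarrow> 'k \<Rightarrow> 'k free_alg \<Rightarrow> 'k::field free_alg set" where
  "M2_class \<alpha> \<beta> p = M2_ideal \<alpha> \<beta> +>\<^bsub>ring_of_type_algebra\<^esub> p"

section \<open>The module\<close>

definition mult_ord :: "'k::field \<Rightarrow> nat" where
  "mult_ord x = group.ord (Multiplicative_Group.mult_of ring_of_type_algebra) x"

definition l1 :: "'k::field \<Rightarrow> 'k \<Rightarrow> nat" where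
  "l1 \<alpha> \<beta> =
    (if mult_ord \<beta> dvd mult_ord (\<alpha> * \<beta>) * mult_ord (\<alpha> * inverse \<beta>)
     then mult_ord (\<alpha> * \<beta>) else 2 * mult_ord (\<alpha> * \<beta>))"

definition l2 :: "'k::field \<Rightarrow> 'k \<Rightarrow> nat" where
  "l2 \<alpha> \<beta> = mult_ord (\<alpha> * inverse \<beta>)"

type_synonym 'k vec = "nat \<times> nat \<Rightarrow>\<^sub>0 'k"

definition e :: "nat \<Rightarrow> nat \<Rightarrow> 'k::field vec" where
  "e a b = Poly_Mapping.single (a, b) 1"

text \<open>The right action of a generator on the basis vector indexed by the last argument.
  The index \<open>(b + (l2 \<alpha> \<beta> - 1)) mod l2 \<alpha> \<beta>\<close> is \<open>b - 1\<close> modulo \<open>l2 \<alpha> \<beta>\<close>.\<close>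

fun V2_gen :: "'k \<Rightarrow> 'k \<Rightarrow> 'k \<Rightarrow> 'k \<Rightarrow> 'k \<Rightarrow> gen \<Rightarrow> nat \<times> nat \<Rightarrow> 'k::field vec" where
  "V2_gen \<alpha> \<beta> \<mu>1 \<mu>2 \<mu>3 X11 (a, b) =
     (if a \<noteq> 0
      then vscale (inverse \<mu>1 * \<mu>3 * inverse \<alpha> * (inverse \<alpha> * \<beta>) ^ b * ((\<alpha> * \<beta>) ^ a - 1))
             (e (a - 1) b)
      else 0)"
| "V2_gen \<alpha> \<beta> \<mu>1 \<mu>2 \<mu>3 X12 (a, b) =
     vscale (inverse \<mu>2 * \<mu>3 * \<beta> ^ a * (inverse \<alpha> * \<beta>) ^ b)
       (e a ((b + (l2 \<alpha> \<beta> - 1)) mod l2 \<alpha> \<beta>))"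
| "V2_gen \<alpha> \<beta> \<mu>1 \<mu>2 \<mu>3 X21 (a, b) =
     vscale (\<mu>2 * \<alpha> ^ a) (e a ((b + 1) mod l2 \<alpha> \<beta>))"
| "V2_gen \<alpha> \<beta> \<mu>1 \<mu>2 \<mu>3 X22 (a, b) =
     (if a \<noteq> l1 \<alpha> \<beta> - 1
      then vscale \<mu>1 (e (a + 1) b)
      else vscale (\<mu>1 * inverse \<alpha> ^ (b * l1 \<alpha> \<beta>)) (e 0 b))"

text \<open>A word acts by its letters from left to right; this is extended linearly to the free
  algebra.\<close>

definition V2_free_act ::
    "'k \<Rightarrow> 'k \<Rightarrow> 'k \<Rightarrow> 'k \<Rightarrow> 'k \<Rightarrow> 'k vec \<Rightarrow> 'k free_alg \<Rightarrow> 'k::field vec" where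
  "V2_free_act \<alpha> \<beta> \<mu>1 \<mu>2 \<mu>3 v p =
     lin_ext (\<lambda>w. foldl (\<lambda>u g. lin_ext (V2_gen \<alpha> \<beta> \<mu>1 \<mu>2 \<mu>3 g) u) v w) p"

text \<open>A coset acts by the common action of all its representatives; \<open>the_elem\<close> gives this
  value when the action is independent of the representative.\<close>

definition V2 ::
    "'k \<Rightarrow> 'k \<Rightarrow> 'k \<Rightarrow> 'k \<Rightarrow> 'k \<Rightarrow> ('k free_alg set, 'k::field vec) right_module" where
  "V2 \<alpha> \<beta> \<mu>1 \<mu>2 \<mu>3 =
    \<lparr>carrier = {v. Poly_Mapping.keys v \<subseteq> {..<l1 \<alpha> \<beta>} \<times> {..<l2 \<alpha> \<beta>}},
     monoid.mult = (\<lambda>_ _. undefined), one = undefined, ring.zero = 0, add = (+),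
     ract = (\<lambda>v C. the_elem (V2_free_act \<alpha> \<beta> \<mu>1 \<mu>2 \<mu>3 v ` C))\<rparr>"

end

theory Submission
  imports Defs
begin

text \<open>The operators \<open>X22 X11\<close>, \<open>X12 X21\<close> and \<open>X21 ^ l2\<close> are diagonal in the basis \<open>e a b\<close>. Their
  eigenvalues determine \<open>(\<alpha>\<inverse>\<beta>)^b\<close>, \<open>(\<alpha>\<beta>)^a\<close> and \<open>\<alpha>^(a l2)\<close>: the first gives \<open>b\<close>, the second gives \<open>a\<close>
  modulo \<open>ord(\<alpha>\<beta>)\<close>, and the third decides between the two remaining values of \<open>a\<close> when
  \<open>l1 = 2 ord(\<alpha>\<beta>)\<close>. Hence every nonzero submodule contains a basis vector, and \<open>X22\<close> and \<open>X21\<close>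
  permute the basis transitively up to nonzero scalars.\<close>

section \<open>Linear extensions\<close>

interpretation vs: vector_space "vscale :: 'k::field \<Rightarrow> ('x \<Rightarrow>\<^sub>0 'k) \<Rightarrow> _"
  by (rule vector_space_vscale)

lemma vscale_single: "vscale c (Poly_Mapping.single x d) = Poly_Mapping.single x (c * d)"
  by (rule poly_mapping_eqI) (simp add: lookup_vscale lookup_single when_def)

text \<open>Updating at a fresh key is the same as adding a monomial, so
  \<open>update_induct\<close> becomes an additive induction. Additive identities then need checking
  on monomials only.\<close>

lemma poly_mapping_add_induct [case_names zero single add]:
  fixes p :: "'x \<Rightarrow>\<^sub>0 'b::comm_monoid_add"
  assumes "P 0" and "\<And>x c. P (Poly_Mapping.single x c)"
    and "\<And>p q. P p \<Longrightarrow> P q \<Longrightarrow> P (p + q)"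
  shows "P p"
proof (induction p rule: update_induct)
  case const
  then show ?case using assms(1) by simp
next
  case (update f a b)
  have "Poly_Mapping.update a b f = Poly_Mapping.single a b + f"
    using update(1)
    by (intro poly_mapping_eqI)
      (auto simp: lookup_update lookup_add lookup_single when_def in_keys_iff)
  then show ?case using assms(2,3) update by simp
qed

lemma sum_mem:
  assumes "0 \<in> S" "\<And>u v. u \<in> S \<Longrightarrow> v \<in> S \<Longrightarrow> u + v \<in> S" "\<And>x. x \<in> A \<Longrightarrow> f x \<in> S"
  shows "sum f A \<in> S"
  using assms(3) by (induction A rule: infinite_finite_induct) (simp_all add: assms(1,2))

text \<open>Keys outside the support contribute zero. This gives several vectors a common summation
  range, as additivity requires.\<close>

lemma lin_ext_superset:
  assumes "finite A" "Poly_Mapping.keys v \<subseteq> A"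
  shows "lin_ext f v = (\<Sum>x\<in>A. vscale (Poly_Mapping.lookup v x) (f x))"
  unfolding lin_ext_def using assms
  by (intro sum.mono_neutral_left) (auto simp: in_keys_iff)

lemma lin_ext_zero [simp]: "lin_ext f 0 = 0"
  by (simp add: lin_ext_def)

lemma lin_ext_eq_zero:
  assumes "\<And>x. x \<in> Poly_Mapping.keys v \<Longrightarrow> f x = 0"
  shows "lin_ext f v = 0"
  using assms by (simp add: lin_ext_def)

lemma lin_ext_single [simp]: "lin_ext f (Poly_Mapping.single x c) = vscale c (f x)"
  by (simp add: lin_ext_superset[where A = "{x}"])

lemma lin_ext_add: "lin_ext f (v + w) = lin_ext f v + lin_ext f w"
proof -
  define A where "A = Poly_Mapping.keys v \<union> Poly_Mapping.keys w"
  have "finite A" "Poly_Mapping.keys v \<subseteq> A" "Poly_Mapping.keys w \<subseteq> A"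
    "Poly_Mapping.keys (v + w) \<subseteq> A"
    using Poly_Mapping.keys_add[of v w] by (auto simp: A_def)
  then show ?thesis
    by (simp add: lin_ext_superset[where A = A] lookup_add vs.scale_left_distrib sum.distrib)
qed

lemma lin_ext_vscale: "lin_ext f (vscale c v) = vscale c (lin_ext f v)"
proof (induction v rule: poly_mapping_add_induct)
  case (add p q)
  then show ?case by (simp add: vs.scale_right_distrib lin_ext_add)
qed (simp_all add: vscale_single)

lemma lin_ext_single_one: "lin_ext (\<lambda>x. Poly_Mapping.single x 1) v = v"
  by (induction v rule: poly_mapping_add_induct) (simp_all add: lin_ext_add vscale_single)

lemma lin_ext_in_vec_space:
  assumes "\<And>x. x \<in> Poly_Mapping.keys v \<Longrightarrow> Poly_Mapping.keys (f x) \<subseteq> I"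
  shows "Poly_Mapping.keys (lin_ext f v) \<subseteq> I"
proof
  fix y assume "y \<in> Poly_Mapping.keys (lin_ext f v)"
  then have "(\<Sum>x\<in>Poly_Mapping.keys v. Poly_Mapping.lookup v x * Poly_Mapping.lookup (f x) y) \<noteq> 0"
    by (simp add: in_keys_iff lin_ext_def lookup_sum lookup_vscale)
  then obtain x where "x \<in> Poly_Mapping.keys v" "Poly_Mapping.lookup (f x) y \<noteq> 0"
    by (elim sum.not_neutral_contains_not_neutral) auto
  then show "y \<in> I" using assms[of x] by (auto simp: in_keys_iff)
qed

text \<open>A nonzero vector of minimal support in \<open>N\<close> must be a multiple of a basis vector, since
  \<open>T - f x\<close> kills one basis vector in its support and keeps another.\<close>

lemma single_mem_of_separating_diagonal:
  fixes N :: "('x \<Rightarrow>\<^sub>0 'k::field) set"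
  assumes scale: "\<And>c v. v \<in> N \<Longrightarrow> vscale c v \<in> N"
    and diff: "\<And>v w. v \<in> N \<Longrightarrow> w \<in> N \<Longrightarrow> v - w \<in> N"
    and supp: "\<And>v. v \<in> N \<Longrightarrow> Poly_Mapping.keys v \<subseteq> I"
    and sep: "\<And>x y. x \<in> I \<Longrightarrow> y \<in> I \<Longrightarrow> x \<noteq> y \<Longrightarrow>
      \<exists>f T. f x \<noteq> f y \<and>
        (\<forall>v\<in>N. T v \<in> N \<and> (\<forall>z. Poly_Mapping.lookup (T v) z = f z * Poly_Mapping.lookup v z))"
    and "v \<in> N" "v \<noteq> 0"
  shows "\<exists>x\<in>I. Poly_Mapping.single x 1 \<in> N"
proof -
  define P where "P n \<longleftrightarrow> (\<exists>v\<in>N. v \<noteq> 0 \<and> card (Poly_Mapping.keys v) = n)" for n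
  have "\<exists>n. P n" using assms(5,6) by (auto simp: P_def)
  then have "P (LEAST n. P n)" by (rule LeastI_ex)
  then obtain u where u: "u \<in> N" "u \<noteq> 0" "card (Poly_Mapping.keys u) = (LEAST n. P n)"
    unfolding P_def[of "LEAST n. P n"] by blast
  then obtain x where x: "x \<in> Poly_Mapping.keys u" by fastforce
  have "Poly_Mapping.keys u = {x}"
  proof (rule ccontr)
    assume "Poly_Mapping.keys u \<noteq> {x}"
    then obtain y where y: "y \<in> Poly_Mapping.keys u" "y \<noteq> x" using x by auto
    have "x \<in> I" "y \<in> I" using x y supp[OF u(1)] by auto
    then obtain f T where f: "f x \<noteq> f y"
      and T: "T u \<in> N" "\<And>z. Poly_Mapping.lookup (T u) z = f z * Poly_Mapping.lookup u z"
      using sep[of x y] y(2) u(1) by metis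
    define w where "w = T u - vscale (f x) u"
    have w: "Poly_Mapping.lookup w z = (f z - f x) * Poly_Mapping.lookup u z" for z
      by (simp add: w_def lookup_minus T lookup_vscale algebra_simps)
    have "w \<in> N" using T u scale diff by (simp add: w_def)
    moreover have "w \<noteq> 0"
      using w[of y] f y(1) by (auto simp: in_keys_iff)
    ultimately have "P (card (Poly_Mapping.keys w))" by (auto simp: P_def)
    then have "card (Poly_Mapping.keys u) \<le> card (Poly_Mapping.keys w)"
      unfolding u(3) by (rule Least_le)
    moreover have "Poly_Mapping.keys w \<subset> Poly_Mapping.keys u"
      using x by (auto simp: in_keys_iff w)
    then have "card (Poly_Mapping.keys w) < card (Poly_Mapping.keys u)"
      by (intro psubset_card_mono) auto
    ultimately show False by simp
  qed
  have "vscale (inverse (Poly_Mapping.lookup u x)) u = Poly_Mapping.single x 1"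
  proof (rule poly_mapping_eqI)
    fix z
    show "Poly_Mapping.lookup (vscale (inverse (Poly_Mapping.lookup u x)) u) z
      = Poly_Mapping.lookup (Poly_Mapping.single x 1) z"
      using x \<open>Poly_Mapping.keys u = {x}\<close> in_keys_iff[of z u] in_keys_iff[of x u]
      by (cases "z = x") (simp_all add: lookup_vscale lookup_single)
  qed
  moreover have "vscale (inverse (Poly_Mapping.lookup u x)) u \<in> N" by (rule scale[OF u(1)])
  ultimately have "Poly_Mapping.single x 1 \<in> N" by (simp only:)
  then show ?thesis using x supp[OF u(1)] by auto
qed

lemma dim_vec_space:
  fixes I :: "'x set"
  assumes "finite I"
  shows "vs.dim {v :: 'x \<Rightarrow>\<^sub>0 'k::field. Poly_Mapping.keys v \<subseteq> I} = card I"
proof (rule vs.dim_unique)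
  let ?b = "\<lambda>x. Poly_Mapping.single x (1::'k)"
  have inj: "inj_on ?b I"
    by (rule inj_onI) (metis lookup_single_eq lookup_single_not_eq one_neq_zero)
  show "?b ` I \<subseteq> {v. Poly_Mapping.keys v \<subseteq> I}" by auto
  show "{v. Poly_Mapping.keys v \<subseteq> I} \<subseteq> vs.span (?b ` I)"
  proof
    fix v :: "'x \<Rightarrow>\<^sub>0 'k" assume "v \<in> {v. Poly_Mapping.keys v \<subseteq> I}"
    then have "v = (\<Sum>x\<in>I. vscale (Poly_Mapping.lookup v x) (?b x))"
      using lin_ext_superset[OF assms, of v ?b] by (simp add: lin_ext_single_one)
    also have "\<dots> \<in> vs.span (?b ` I)"
      by (intro vs.span_sum vs.span_scale vs.span_base) auto
    finally show "v \<in> vs.span (?b ` I)" .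
  qed
  show "vs.independent (?b ` I)"
  proof
    assume "vs.dependent (?b ` I)"
    then obtain u where u: "\<exists>v\<in>?b ` I. u v \<noteq> 0" "(\<Sum>v\<in>?b ` I. vscale (u v) v) = 0"
      using vs.dependent_finite[of "?b ` I"] assms by blast
    then obtain x where x: "x \<in> I" "u (?b x) \<noteq> 0" by auto
    \<comment> \<open>Injectivity turns a relation indexed by a set of vectors into one indexed by
      \<open>I\<close>; its coordinate at \<open>x\<close> is then the single coefficient
      \<open>u (?b x)\<close>.\<close>
    have "(\<Sum>y\<in>I. vscale (u (?b y)) (?b y)) = 0"
      using u(2) by (simp only: sum.reindex[OF inj] o_def)
    then have "0 = Poly_Mapping.lookup (\<Sum>y\<in>I. vscale (u (?b y)) (?b y)) x"
      by (simp only: lookup_zero)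
    also have "\<dots> = (\<Sum>y\<in>I. u (?b y) * (1 when y = x))"
      by (simp only: lookup_sum lookup_vscale lookup_single)
    also have "\<dots> = (\<Sum>y\<in>I. if y = x then u (?b y) else 0)"
      by (rule sum.cong) (simp_all add: when_def)
    also have "\<dots> = u (?b x)"
      using assms x(1) by simp
    finally show False using x(2) by simp
  qed
  show "card (?b ` I) = card I" by (rule card_image[OF inj])
qed

section \<open>Actions of the free algebra\<close>

lemma ring_ring_of_type_algebra: "ring (ring_of_type_algebra :: 'a::ring_1 ring)"
proof -
  have "\<exists>y. y + x = 0 \<and> x + y = 0" for x :: 'a
    by (rule exI[of _ "-x"]) simp
  then show ?thesis
    unfolding ring_of_type_algebra_def
    by unfold_locales (auto simp: algebra_simps Units_def)
qed

lemma a_inv_ring_of_type_algebra: "\<ominus>\<^bsub>ring_of_type_algebra\<^esub> x = - (x :: 'a::ring_1)"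
proof -
  interpret ring "ring_of_type_algebra :: 'a ring" by (rule ring_ring_of_type_algebra)
  show ?thesis
    by (rule minus_equality) (simp_all add: ring_of_type_algebra_def)
qed

text \<open>Additive inverses are obtained by left multiplication with \<open>-1\<close>.\<close>

lemma ideal_ring_of_type_algebraI:
  fixes J :: "'a::ring_1 set"
  assumes "0 \<in> J" "\<And>p q. p \<in> J \<Longrightarrow> q \<in> J \<Longrightarrow> p + q \<in> J"
    and "\<And>p r. p \<in> J \<Longrightarrow> r * p \<in> J" "\<And>p r. p \<in> J \<Longrightarrow> p * r \<in> J"
  shows "ideal J ring_of_type_algebra"
proof (rule idealI[OF ring_ring_of_type_algebra])
  have "\<ominus>\<^bsub>ring_of_type_algebra\<^esub> p \<in> J" if "p \<in> J" for p
    using assms(3)[OF that, of "-1"] by (simp add: a_inv_ring_of_type_algebra)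
  then show "subgroup J (add_monoid ring_of_type_algebra)"
    using assms(1,2)
    by (intro subgroup.intro) (simp_all add: a_inv_def, simp_all add: ring_of_type_algebra_def)
qed (use assms in \<open>auto simp: ring_of_type_algebra_def\<close>)

text \<open>Carries the order in the multiplicative group over to ordinary powers. An element of
  infinite order has \<open>mult_ord\<close> equal to \<open>0\<close>, which is why positivity is
  derived later from an explicit power equal to \<open>1\<close>.\<close>

lemma mult_ord_dvd_iff:
  assumes "x \<noteq> (0::'k::field)"
  shows "mult_ord x dvd n \<longleftrightarrow> x ^ n = 1"
proof -
  interpret F: Ring.field "ring_of_type_algebra :: 'k ring" ..
  interpret G: group "Multiplicative_Group.mult_of (ring_of_type_algebra :: 'k ring)"
    by (rule F.field_mult_group)
  have x: "x \<in> carrier (Multiplicative_Group.mult_of (ring_of_type_algebra :: 'k ring))"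
    using assms by (simp add: ring_of_type_algebra_def)
  have "x [^]\<^bsub>ring_of_type_algebra\<^esub> n = x ^ n"
    by (induction n) (simp_all add: ring_of_type_algebra_def)
  then show ?thesis
    using G.pow_eq_id[OF x, of n] unfolding mult_ord_def
    by (simp add: Multiplicative_Group.nat_pow_mult_of) (simp add: ring_of_type_algebra_def)
qed

text \<open>\<open>V2_gen\<close> is defined on all pairs of naturals, so the free algebra acts on
  every finitely supported vector. The index rectangle and the conditions on the parameters enter
  only in \<open>V2_roots\<close>.\<close>

locale V2_params =
  fixes \<alpha> \<beta> \<mu>1 \<mu>2 \<mu>3 :: "'k::field"
begin

abbreviation gact :: "gen \<Rightarrow> 'k vec \<Rightarrow> 'k vec" where
  "gact g \<equiv> lin_ext (V2_gen \<alpha> \<beta> \<mu>1 \<mu>2 \<mu>3 g)"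

abbreviation wact :: "'k vec \<Rightarrow> gen list \<Rightarrow> 'k vec" where
  "wact \<equiv> foldl (\<lambda>u g. gact g u)"

abbreviation act :: "'k vec \<Rightarrow> 'k free_alg \<Rightarrow> 'k vec" where
  "act \<equiv> V2_free_act \<alpha> \<beta> \<mu>1 \<mu>2 \<mu>3"

lemma wact_add: "wact (v + v') w = wact v w + wact v' w"
  by (induction w arbitrary: v v') (simp_all add: lin_ext_add)

lemma wact_vscale: "wact (vscale c v) w = vscale c (wact v w)"
  by (induction w arbitrary: v) (simp_all add: lin_ext_vscale)

lemma act_zero_right [simp]: "act v 0 = 0"
  by (simp add: V2_free_act_def)

lemma act_single: "act v (Poly_Mapping.single w c) = vscale c (wact v w)"
  by (simp add: V2_free_act_def)

lemma act_add_right: "act v (p + q) = act v p + act v q"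
  by (simp add: V2_free_act_def lin_ext_add)

lemma act_add_left: "act (v + w) p = act v p + act w p"
  by (induction p rule: poly_mapping_add_induct)
    (simp_all add: act_single wact_add vs.scale_right_distrib act_add_right)

lemma act_vscale_left: "act (vscale c v) p = vscale c (act v p)"
  by (induction p rule: poly_mapping_add_induct)
    (simp_all add: act_single wact_vscale vs.scale_right_distrib act_add_right mult.commute)

lemma act_zero_left [simp]: "act 0 p = 0"
  using act_vscale_left[of 0 0 p] by simp

lemma act_diff_right: "act v (p - q) = act v p - act v q"
  using act_add_right[of v "p - q" q] by (simp add: algebra_simps)

text \<open>On monomials this is \<open>foldl\<close> over a concatenation: the left factor acts
  first, as a right action demands. Biadditivity does the rest.\<close>

lemma act_mult: "act v (p * q) = act (act v p) q"
proof (induction p rule: poly_mapping_add_induct)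
  case (single x c)
  show ?case
    by (induction q rule: poly_mapping_add_induct)
      (simp_all add: act_single wact_vscale mult_single plus_list_def mult.commute
        distrib_left act_add_right)
next
  case (add p p')
  then show ?case by (simp add: distrib_right act_add_right act_add_left)
qed simp_all

lemma act_gvar: "act v (gvar g) = gact g v"
  by (simp add: gvar_def act_single)

lemma act_scalar: "act v (scalar c) = vscale c v"
  by (simp add: scalar_def act_single)

lemma act_one: "act v 1 = v"
  by (simp add: act_single zero_list_def flip: single_one)

lemma act_eq_lin_ext: "act v p = lin_ext (\<lambda>x. act (Poly_Mapping.single x 1) p) v"
proof (induction v rule: poly_mapping_add_induct)
  case (single x c)
  then show ?case using act_vscale_left[of c "Poly_Mapping.single x 1" p] by (simp add: vscale_single)
qed (simp_all add: act_add_left lin_ext_add)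

lemma act_mult_gvar: "act v (gvar g * gvar h) = gact h (gact g v)"
  by (simp add: act_mult act_gvar)

lemma act_scalar_mult: "act v (scalar c * p) = vscale c (act v p)"
  by (simp add: act_mult act_scalar act_vscale_left)

lemma gact_e: "gact g (e a b) = V2_gen \<alpha> \<beta> \<mu>1 \<mu>2 \<mu>3 g (a, b)"
  by (simp add: e_def)

end

section \<open>The module at roots of unity\<close>

lemma mult_ord_pos: "x \<noteq> 0 \<Longrightarrow> n > 0 \<Longrightarrow> x ^ n = 1 \<Longrightarrow> mult_ord (x::'k::field) > 0"
  using mult_ord_dvd_iff[of x n] dvd_pos_nat[of n] by blast

lemma power_mult_ord: "x \<noteq> 0 \<Longrightarrow> (x::'k::field) ^ mult_ord x = 1"
  using mult_ord_dvd_iff[of x "mult_ord x"] by simp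

lemma power_mod_eq: "(x::'k::monoid_mult) ^ n = 1 \<Longrightarrow> x ^ (m mod n) = x ^ m"
  by (metis mod_mult_div_eq mult.right_neutral power_add power_mult power_one)

lemma power_eq_one_mult: "(x::'k::monoid_mult) ^ n = 1 \<Longrightarrow> x ^ (n * m) = 1"
  by (simp add: power_mult)

lemma power_diff_eq_one:
  assumes "(x::'k::field) \<noteq> 0" "x ^ m = x ^ n"
  shows "x ^ (m - n) = 1"
  using assms by (cases "n \<le> m") (simp_all add: power_diff)

text \<open>Both \<open>x\<close> and \<open>y\<close> are recovered from the two given quantities
  by the same formula. It is applied with \<open>x\<close> and \<open>y\<close> powers of
  \<open>q\<close>, \<open>u\<close> and \<open>v\<close> powers of \<open>p\<close>, and
  \<open>c = p\<close>, to eliminate the powers of \<open>p\<close> from two eigenvalues.\<close>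

lemma eq_of_weighted_eq:
  fixes x y u v c :: "'k::comm_ring_1"
  assumes "u * x = v * y" "x * (c * u - 1) = y * (c * v - 1)"
  shows "x = y"
proof -
  have "x = c * (u * x) - x * (c * u - 1)" "y = c * (v * y) - y * (c * v - 1)"
    by (simp_all add: algebra_simps)
  then show ?thesis using assms by simp
qed

locale V2_roots = V2_params \<alpha> \<beta> \<mu>1 \<mu>2 \<mu>3
  for \<alpha> \<beta> \<mu>1 \<mu>2 \<mu>3 :: "'k::field" +
  assumes alpha_nz: "\<alpha> \<noteq> 0" and beta_nz: "\<beta> \<noteq> 0"
    and alpha_root: "\<exists>n>0. \<alpha> ^ n = 1" and beta_root: "\<exists>n>0. \<beta> ^ n = 1"
    and alpha_beta: "\<alpha> * \<beta> \<noteq> 1"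
    and mu_nz: "\<mu>1 \<noteq> 0" "\<mu>2 \<noteq> 0" "\<mu>3 \<noteq> 0"
begin

section \<open>Periods of the scalars occurring in the action\<close>

abbreviation L1 :: nat where "L1 \<equiv> l1 \<alpha> \<beta>"
abbreviation L2 :: nat where "L2 \<equiv> l2 \<alpha> \<beta>"
abbreviation p :: 'k where "p \<equiv> \<alpha> * \<beta>"
abbreviation q :: 'k where "q \<equiv> inverse \<alpha> * \<beta>"

definition V :: "'k vec set" where
  "V = {v. Poly_Mapping.keys v \<subseteq> {..<L1} \<times> {..<L2}}"

text \<open>\<open>q\<close> is the inverse of the element whose order defines \<open>l2\<close>,
  and inverse elements have equal order.\<close>

lemma q_power_eq_one_iff: "q ^ n = 1 \<longleftrightarrow> L2 dvd n"
proof -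
  have "q = inverse (\<alpha> * inverse \<beta>)"
    using alpha_nz beta_nz by simp
  then have "q ^ n = 1 \<longleftrightarrow> (\<alpha> * inverse \<beta>) ^ n = 1"
    by (metis inverse_1 inverse_inverse_eq power_inverse)
  then show ?thesis
    using mult_ord_dvd_iff[of "\<alpha> * inverse \<beta>" n] alpha_nz beta_nz by (simp add: l2_def)
qed

lemma ord_p_pos: "mult_ord p > 0" and L2_pos: "L2 > 0"
proof -
  obtain m n where "m > 0" "\<alpha> ^ m = 1" "n > 0" "\<beta> ^ n = 1"
    using alpha_root beta_root by auto
  then have "\<alpha> ^ (m * n) = 1" "\<beta> ^ (m * n) = 1" "m * n > 0"
    using power_eq_one_mult[of \<alpha> m n] power_eq_one_mult[of \<beta> n m] by (simp_all add: mult.commute)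
  then show "mult_ord p > 0" "L2 > 0"
    using mult_ord_pos[of p "m * n"] mult_ord_pos[of "\<alpha> * inverse \<beta>" "m * n"] alpha_nz beta_nz
    by (simp_all add: power_mult_distrib power_inverse l2_def)
qed

lemma q_L2: "q ^ L2 = 1"
  by (simp only: q_power_eq_one_iff dvd_refl)

lemma p_ord: "p ^ mult_ord p = 1"
  using power_mult_ord[of p] alpha_nz beta_nz by simp

lemma p_L1: "p ^ L1 = 1"
  using power_eq_one_mult[OF p_ord, of 2] p_ord by (simp add: l1_def mult.commute)

lemma L1_gt_1: "L1 > 1"
proof -
  have "mult_ord p \<noteq> 1" using p_ord alpha_beta by auto
  then show ?thesis using ord_p_pos by (simp add: l1_def)
qed

text \<open>This is the purpose of the doubling in \<open>l1\<close>. Since \<beta>^2 = p q, twice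
  \<open>mult_ord p * L2\<close> always annihilates \<beta>, and the factor 2 is inserted exactly
  when \<open>mult_ord p * L2\<close> alone does not. Together with \<open>p_L1\<close> it gives the
  same period for \<alpha>.\<close>

lemma beta_L1_L2: "\<beta> ^ (L1 * L2) = 1"
proof (cases "mult_ord \<beta> dvd mult_ord p * L2")
  case True
  then show ?thesis
    using mult_ord_dvd_iff[OF beta_nz] by (simp add: l1_def l2_def)
next
  case False
  have "\<beta> * \<beta> = p * q" using alpha_nz by simp
  then have "\<beta> ^ (2 * (mult_ord p * L2)) = (p * q) ^ (mult_ord p * L2)"
    by (simp only: power_mult power2_eq_square)
  also have "\<dots> = p ^ (mult_ord p * L2) * q ^ (L2 * mult_ord p)"
    by (simp only: power_mult_distrib mult.commute)
  also have "\<dots> = 1"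
    using power_eq_one_mult[OF p_ord] power_eq_one_mult[OF q_L2] by simp
  finally show ?thesis using False by (simp add: l1_def l2_def mult.assoc)
qed

lemma alpha_L1_L2: "\<alpha> ^ (L1 * L2) = 1"
  using power_eq_one_mult[OF p_L1, of L2] beta_L1_L2 by (simp add: power_mult_distrib)

lemma q_succ: "q ^ ((b + 1) mod L2) = q ^ b * q"
  using power_mod_eq[OF q_L2, of "b + 1"] by (simp add: mult.commute)

lemma q_pred: "q ^ ((b + (L2 - 1)) mod L2) = q ^ b * inverse q"
proof -
  have "q ^ ((b + (L2 - 1)) mod L2) * q = q ^ (b + L2)"
    using L2_pos power_mod_eq[OF q_L2, of "b + (L2 - 1)"] by (simp flip: power_Suc2)
  also have "\<dots> = q ^ b" using q_L2 by (simp add: power_add)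
  finally show ?thesis
    using alpha_nz beta_nz by (simp add: field_simps)
qed

text \<open>The scalar that \<open>X22\<close> picks up on wrapping from \<open>L1 - 1\<close> to
  \<open>0\<close> depends only on \<open>b\<close> modulo \<open>L2\<close>, so it is compatible
  with the cyclic shifts by \<open>X12\<close> and \<open>X21\<close>.\<close>

lemma inverse_alpha_L1: "inverse \<alpha> ^ (b mod L2 * L1) = inverse \<alpha> ^ (b * L1)"
proof -
  have "(inverse \<alpha> ^ L1) ^ L2 = 1"
    using alpha_L1_L2 by (simp add: power_inverse flip: power_mult)
  from power_mod_eq[OF this, of b] show ?thesis
    by (simp add: mult.commute flip: power_mult)
qed

section \<open>The generators on basis vectors and the defining relations\<close>

lemma succ_pred: "b < L2 \<Longrightarrow> ((b + (L2 - 1)) mod L2 + 1) mod L2 = b"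
  using L2_pos by (simp add: mod_Suc_eq)

lemma pred_succ: "b < L2 \<Longrightarrow> ((b + 1) mod L2 + (L2 - 1)) mod L2 = b"
  using L2_pos mod_add_left_eq[of "b + 1" L2 "L2 - 1"] by simp

text \<open>At \<open>a = 0\<close> the factor \<open>p ^ a - 1\<close> vanishes, so one formula
  covers both cases and the truncated \<open>a - 1\<close> does no harm.\<close>

lemma gact_X11_e:
  "gact X11 (e a b) = vscale (inverse \<mu>1 * \<mu>3 * inverse \<alpha> * q ^ b * (p ^ a - 1)) (e (a - 1) b)"
  by (cases a) (simp_all add: gact_e)

lemma gact_X22_e:
  assumes "a < L1"
  shows "gact X22 (e a b) =
    vscale (\<mu>1 * (if Suc a = L1 then inverse \<alpha> ^ (b * L1) else 1)) (e (Suc a mod L1) b)"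
  using assms by (auto simp: gact_e)

lemmas gact_basis = gact_X11_e gact_X22_e gact_e[of X12] gact_e[of X21] lin_ext_vscale

lemma gact_X22_X11:
  assumes "a < L1"
  shows "gact X11 (gact X22 (e a b)) = vscale (\<mu>3 * inverse \<alpha> * q ^ b * (p ^ Suc a - 1)) (e a b)"
proof (cases "Suc a = L1")
  case True
  \<comment> \<open>After wrapping, \<open>X11\<close> kills \<open>e 0 b\<close>; the claimed
    eigenvalue vanishes too, because \<open>p ^ L1 = 1\<close>.\<close>
  then show ?thesis using assms p_L1 by (simp add: gact_basis del: power_Suc)
next
  case False
  then show ?thesis using assms mu_nz by (simp add: gact_basis)
qed

lemma gact_X11_X22:
  assumes "a < L1"
  shows "gact X22 (gact X11 (e a b)) = vscale (\<mu>3 * inverse \<alpha> * q ^ b * (p ^ a - 1)) (e a b)"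
  using assms mu_nz by (cases a) (simp_all add: gact_basis)

lemma gact_X12_X21:
  assumes "b < L2"
  shows "gact X21 (gact X12 (e a b)) = vscale (\<mu>3 * p ^ a * q ^ b) (e a b)"
  using assms mu_nz succ_pred[OF assms] by (simp add: gact_basis power_mult_distrib)

lemma gact_relations:
  assumes "a < L1" "b < L2"
  shows "gact X11 (gact X12 (e a b)) = vscale \<alpha> (gact X12 (gact X11 (e a b)))"
    and "gact X21 (gact X22 (e a b)) = vscale \<alpha> (gact X22 (gact X21 (e a b)))"
    and "gact X11 (gact X21 (e a b)) = vscale \<beta> (gact X21 (gact X11 (e a b)))"
    and "gact X12 (gact X22 (e a b)) = vscale \<beta> (gact X22 (gact X12 (e a b)))"
    and "gact X12 (gact X21 (e a b)) = vscale (\<beta> * inverse \<alpha>) (gact X21 (gact X12 (e a b)))"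
    and "gact X11 (gact X22 (e a b)) - gact X22 (gact X11 (e a b)) =
      vscale (\<beta> - inverse \<alpha>) (gact X21 (gact X12 (e a b)))"
proof -
  let ?b' = "(b + 1) mod L2" and ?b'' = "(b + (L2 - 1)) mod L2"
  show "gact X11 (gact X12 (e a b)) = vscale \<alpha> (gact X12 (gact X11 (e a b)))"
  proof (cases a)
    case (Suc a')
    have "inverse \<mu>2 * \<mu>3 * \<beta> ^ a * q ^ b * (inverse \<mu>1 * \<mu>3 * inverse \<alpha> * q ^ ?b'' * (p ^ a - 1))
      = \<alpha> * (inverse \<mu>1 * \<mu>3 * inverse \<alpha> * q ^ b * (p ^ a - 1) * (inverse \<mu>2 * \<mu>3 * \<beta> ^ a' * q ^ b))"
      unfolding q_pred using alpha_nz beta_nz Suc by simp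
    then show ?thesis using Suc by (simp add: gact_basis)
  qed (simp add: gact_basis)
  show "gact X21 (gact X22 (e a b)) = vscale \<alpha> (gact X22 (gact X21 (e a b)))"
  proof (cases "Suc a = L1")
    case True
    \<comment> \<open>Wrapping after raising \<open>b\<close> contributes an extra \<alpha>^(-L1);
      the factor from the relation and the one from \<open>X21\<close> combine to cancel it.\<close>
    have "\<alpha> * \<alpha> ^ a = \<alpha> ^ L1" using True by (metis power_Suc)
    then have "\<mu>1 * inverse \<alpha> ^ (b * L1) * \<mu>2
      = \<alpha> * (\<mu>2 * \<alpha> ^ a * (\<mu>1 * inverse \<alpha> ^ (?b' * L1)))"
      unfolding inverse_alpha_L1 using alpha_nz by (simp add: power_add power_inverse field_simps)
    then show ?thesis using True assms by (simp add: gact_basis)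
  next
    case False
    then show ?thesis using assms by (simp add: gact_basis)
  qed
  show "gact X11 (gact X21 (e a b)) = vscale \<beta> (gact X21 (gact X11 (e a b)))"
  proof (cases a)
    case (Suc a')
    have "\<mu>2 * \<alpha> ^ a * (inverse \<mu>1 * \<mu>3 * inverse \<alpha> * q ^ ?b' * (p ^ a - 1))
      = \<beta> * (inverse \<mu>1 * \<mu>3 * inverse \<alpha> * q ^ b * (p ^ a - 1) * (\<mu>2 * \<alpha> ^ a'))"
      unfolding q_succ using alpha_nz beta_nz Suc by simp
    then show ?thesis using Suc by (simp add: gact_basis)
  qed (simp add: gact_basis)
  show "gact X12 (gact X22 (e a b)) = vscale \<beta> (gact X22 (gact X12 (e a b)))"
  proof (cases "Suc a = L1")
    case True
    have *: "\<beta> * \<beta> ^ a = \<beta> ^ L1" using True by (metis power_Suc)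
    \<comment> \<open>Lowering \<open>b\<close> by one modulo \<open>L2\<close> changes the wrapping
      scalar by \<alpha>^L1, the term \<open>L2 * L1\<close> being a period.\<close>
    have "(b + (L2 - 1)) * L1 + L1 = b * L1 + L2 * L1"
      using L2_pos by (cases L2) (simp_all add: algebra_simps)
    then have "inverse \<alpha> ^ ((b + (L2 - 1)) * L1) * inverse \<alpha> ^ L1
      = inverse \<alpha> ^ (b * L1) * inverse \<alpha> ^ (L2 * L1)"
      by (simp only: power_add[symmetric])
    then have "inverse \<alpha> ^ (?b'' * L1) = inverse \<alpha> ^ (b * L1) * inverse \<alpha> ^ (L2 * L1) * \<alpha> ^ L1"
      unfolding inverse_alpha_L1 using alpha_nz by (simp add: power_inverse field_simps)
    also have "\<dots> = inverse \<alpha> ^ (b * L1) * \<alpha> ^ L1"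
      using alpha_L1_L2 by (simp add: power_inverse mult.commute)
    finally have **: "inverse \<alpha> ^ (?b'' * L1) = inverse \<alpha> ^ (b * L1) * \<alpha> ^ L1" .
    \<comment> \<open>The surplus of the right-hand side of the relation is \<open>p ^ L1\<close>,
      hence trivial.\<close>
    have "\<beta> * (\<beta> ^ a * \<alpha> ^ L1) = \<alpha> ^ L1 * \<beta> ^ L1"
      by (simp only: mult.assoc[symmetric] *) (rule mult.commute)
    also have "\<dots> = 1" using p_L1 by (simp only: power_mult_distrib)
    finally have "\<mu>1 * inverse \<alpha> ^ (b * L1) * (inverse \<mu>2 * \<mu>3 * q ^ b)
      = \<beta> * (inverse \<mu>2 * \<mu>3 * \<beta> ^ a * q ^ b * (\<mu>1 * inverse \<alpha> ^ (?b'' * L1)))"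
      unfolding ** by (simp add: algebra_simps)
    then show ?thesis using True assms by (simp add: gact_basis)
  next
    case False
    then show ?thesis using assms by (simp add: gact_basis)
  qed
  show "gact X12 (gact X21 (e a b)) = vscale (\<beta> * inverse \<alpha>) (gact X21 (gact X12 (e a b)))"
  proof -
    have "\<mu>2 * \<alpha> ^ a * (inverse \<mu>2 * \<mu>3 * \<beta> ^ a * q ^ ?b')
      = \<beta> * inverse \<alpha> * (\<mu>3 * p ^ a * q ^ b)"
      unfolding q_succ using mu_nz by (simp add: power_mult_distrib)
    then show ?thesis
      using pred_succ[OF assms(2)] gact_X12_X21[OF assms(2), of a] by (simp add: gact_basis)
  qed
  show "gact X11 (gact X22 (e a b)) - gact X22 (gact X11 (e a b)) =
      vscale (\<beta> - inverse \<alpha>) (gact X21 (gact X12 (e a b)))"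
    \<comment> \<open>All three operators are diagonal, and the eigenvalues match because
      \<open>inverse \<alpha> * (p - 1) = \<beta> - inverse \<alpha>\<close>.\<close>
    unfolding gact_X22_X11[OF assms(1)] gact_X11_X22[OF assms(1)] gact_X12_X21[OF assms(2)]
    using alpha_nz by (simp add: field_simps flip: vs.scale_left_diff_distrib)
qed

section \<open>Descent of the action to the quotient algebra\<close>

lemma act_relator:
  assumes "r \<in> M2_relators \<alpha> \<beta>" "v \<in> V"
  shows "act v r = 0"
proof -
  have "act (e a b) r = 0" if "a < L1" "b < L2" for a b
    using assms(1) gact_relations[OF that] unfolding M2_relators_def
    by (elim insertE emptyE) (simp_all add: act_diff_right act_mult_gvar act_scalar_mult)
  then have "act (Poly_Mapping.single x 1) r = 0" if "x \<in> Poly_Mapping.keys v" for x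
    using that assms(2) unfolding V_def e_def by (cases x) blast
  then show ?thesis
    by (subst act_eq_lin_ext) (rule lin_ext_eq_zero)
qed

lemma gact_in_V:
  assumes "v \<in> V"
  shows "gact g v \<in> V"
  unfolding V_def
proof (intro CollectI lin_ext_in_vec_space)
  fix x assume "x \<in> Poly_Mapping.keys v"
  then obtain a b where "x = (a, b)" "a < L1" "b < L2"
    using assms by (cases x) (auto simp: V_def)
  then show "Poly_Mapping.keys (V2_gen \<alpha> \<beta> \<mu>1 \<mu>2 \<mu>3 g x) \<subseteq> {..<L1} \<times> {..<L2}"
    using L1_gt_1 L2_pos by (cases g) (auto simp: e_def vscale_single split: if_splits)
qed

lemma vscale_in_V: "v \<in> V \<Longrightarrow> vscale c v \<in> V"
  by (auto simp: V_def in_keys_iff lookup_vscale subset_iff)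

lemma add_in_V: "v \<in> V \<Longrightarrow> w \<in> V \<Longrightarrow> v + w \<in> V"
  using Poly_Mapping.keys_add[of v w] by (auto simp: V_def)

lemma zero_in_V: "0 \<in> V"
  by (simp add: V_def)

lemma act_in_V:
  assumes "v \<in> V"
  shows "act v x \<in> V"
proof (induction x rule: poly_mapping_add_induct)
  case (single w c)
  have "wact v w \<in> V"
    using assms by (induction w arbitrary: v) (simp_all add: gact_in_V)
  then show ?case unfolding act_single by (rule vscale_in_V)
next
  case (add x y)
  then show ?case unfolding act_add_right by (rule add_in_V)
qed (simp add: zero_in_V)

sublocale F: ring "ring_of_type_algebra :: 'k free_alg ring"
  by (rule ring_ring_of_type_algebra)

sublocale I: ideal "M2_ideal \<alpha> \<beta>" "ring_of_type_algebra :: 'k free_alg ring"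
  unfolding M2_ideal_def by (rule F.genideal_ideal) (simp add: ring_of_type_algebra_def)

lemma act_ideal:
  assumes "x \<in> M2_ideal \<alpha> \<beta>" "v \<in> V"
  shows "act v x = 0"
proof -
  \<comment> \<open>The annihilator of \<open>V\<close> is two-sided: closure under left
    multiplication uses that \<open>V\<close> is stable under the action. It contains the relators,
    hence the ideal they generate.\<close>
  have "ideal {x. \<forall>v\<in>V. act v x = 0} ring_of_type_algebra"
    by (intro ideal_ring_of_type_algebraI) (simp_all add: act_add_right act_mult act_in_V)
  then have "M2_ideal \<alpha> \<beta> \<subseteq> {x. \<forall>v\<in>V. act v x = 0}"
    unfolding M2_ideal_def by (rule F.genideal_minimal) (use act_relator in blast)
  then show ?thesis using assms by blast
qed

section \<open>The right module over the quotient ring\<close>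

abbreviation R :: "'k free_alg set ring" where "R \<equiv> M2 \<alpha> \<beta>"
abbreviation M :: "('k free_alg set, 'k vec) right_module" where
  "M \<equiv> V2 \<alpha> \<beta> \<mu>1 \<mu>2 \<mu>3"
abbreviation cl :: "'k free_alg \<Rightarrow> 'k free_alg set" where "cl \<equiv> M2_class \<alpha> \<beta>"

lemma M_simps [simp]: "carrier M = V" "\<zero>\<^bsub>M\<^esub> = 0" "v \<oplus>\<^bsub>M\<^esub> w = v + w"
  by (simp_all add: V2_def V_def)

lemma carrier_R: "carrier R = range cl"
  by (auto simp: M2_def FactRing_def A_RCOSETS_def' M2_class_def ring_of_type_algebra_def)

lemma R_simps:
  "cl x \<oplus>\<^bsub>R\<^esub> cl y = cl (x + y)" "cl x \<otimes>\<^bsub>R\<^esub> cl y = cl (x * y)" "\<one>\<^bsub>R\<^esub> = cl 1"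
  using I.a_rcos_sum[of x y] I.rcoset_mult_add[of x y]
  by (simp_all add: M2_def FactRing_def M2_class_def ring_of_type_algebra_def)

text \<open>Representatives differ by elements of the ideal, which annihilate \<open>V\<close>; the
  image of the coset is therefore a singleton and \<open>the_elem\<close> returns its
  member.\<close>

lemma ract_cl:
  assumes "v \<in> V"
  shows "v \<cdot>\<^bsub>M\<^esub> cl x = act v x"
proof -
  have const: "act v y = act v x" if "y \<in> cl x" for y
    using that act_ideal[OF _ assms]
    by (auto simp: M2_class_def a_r_coset_def' ring_of_type_algebra_def act_add_right)
  have "x \<in> cl x"
    using I.a_rcos_self[of x] by (simp add: M2_class_def ring_of_type_algebra_def)
  have "act v ` cl x = (\<lambda>_. act v x) ` cl x"
    by (rule image_cong[OF refl]) (rule const)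
  also have "\<dots> = {act v x}"
    using \<open>x \<in> cl x\<close> by (rule image_constant)
  finally show ?thesis by (simp add: V2_def)
qed

lemma right_module_M: "right_module R M"
proof (intro right_module.intro right_module_axioms.intro)
  show "ring R" unfolding M2_def by (rule I.quotient_is_ring)
  show "abelian_group M"
  proof (rule abelian_groupI)
    fix v assume "v \<in> carrier M"
    then show "\<exists>w\<in>carrier M. w \<oplus>\<^bsub>M\<^esub> v = \<zero>\<^bsub>M\<^esub>"
      using vscale_in_V[of v "-1"] by (intro bexI[of _ "- v"]) simp_all
  qed (simp_all add: add_in_V zero_in_V add_ac)
  fix v w r s
  assume v: "v \<in> carrier M"
  then have v': "v \<in> V" by simp
  show "v \<cdot>\<^bsub>M\<^esub> \<one>\<^bsub>R\<^esub> = v"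
    by (simp only: R_simps ract_cl[OF v'] act_one)
  assume "r \<in> carrier R"
  then obtain x where r: "r = cl x" by (auto simp: carrier_R)
  show "v \<cdot>\<^bsub>M\<^esub> r \<in> carrier M"
    unfolding r ract_cl[OF v'] using act_in_V[OF v'] by simp
  {
    assume "w \<in> carrier M"
    then have w': "w \<in> V" by simp
    show "(v \<oplus>\<^bsub>M\<^esub> w) \<cdot>\<^bsub>M\<^esub> r = v \<cdot>\<^bsub>M\<^esub> r \<oplus>\<^bsub>M\<^esub> w \<cdot>\<^bsub>M\<^esub> r"
      by (simp only: r M_simps ract_cl[OF v'] ract_cl[OF w'] ract_cl[OF add_in_V[OF v' w']]
          act_add_left)
  }
  assume "s \<in> carrier R"
  then obtain y where s: "s = cl y" by (auto simp: carrier_R)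
  show "v \<cdot>\<^bsub>M\<^esub> (r \<oplus>\<^bsub>R\<^esub> s) = v \<cdot>\<^bsub>M\<^esub> r \<oplus>\<^bsub>M\<^esub> v \<cdot>\<^bsub>M\<^esub> s"
    by (simp only: r s R_simps M_simps ract_cl[OF v'] act_add_right)
  show "v \<cdot>\<^bsub>M\<^esub> (r \<otimes>\<^bsub>R\<^esub> s) = (v \<cdot>\<^bsub>M\<^esub> r) \<cdot>\<^bsub>M\<^esub> s"
    by (simp only: r s R_simps ract_cl[OF v'] ract_cl[OF act_in_V[OF v']] act_mult)
qed

section \<open>Joint eigenvalues determine the basis index\<close>

lemma weights_separate:
  assumes "a \<le> a'" "a' < L1" "b < L2" "b' < L2"
    and X11_X22: "q ^ b * (p ^ Suc a - 1) = q ^ b' * (p ^ Suc a' - 1)"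
    and X12_X21: "p ^ a * q ^ b = p ^ a' * q ^ b'"
    and X21_pow: "\<alpha> ^ (a * L2) = \<alpha> ^ (a' * L2)"
  shows "a = a' \<and> b = b'"
proof -
  have nz: "p \<noteq> 0" "q \<noteq> 0" using alpha_nz beta_nz by auto
  have q_eq: "q ^ b = q ^ b'"
    by (rule eq_of_weighted_eq[OF X12_X21, of p]) (use X11_X22 in \<open>simp only: power_Suc\<close>)
  \<comment> \<open>Subtraction is truncated, so both differences are considered; each is a multiple
    of \<open>L2\<close> below \<open>L2\<close>, hence zero.\<close>
  have "L2 dvd b' - b" "L2 dvd b - b'"
    using power_diff_eq_one[OF nz(2) q_eq] power_diff_eq_one[OF nz(2) q_eq[symmetric]]
    by (simp_all only: q_power_eq_one_iff)
  then have "b' - b = 0" "b - b' = 0"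
    using assms(3,4) dvd_imp_le[of L2 "b' - b"] dvd_imp_le[of L2 "b - b'"] by linarith+
  then have b: "b = b'" by simp
  define d where "d = a' - a"
  have "p ^ a * q ^ b' = p ^ a' * q ^ b'"
    using X12_X21 by (simp only: q_eq)
  then have "p ^ a' = p ^ a"
    using nz by (simp only: mult_cancel_right power_eq_0_iff) simp
  then have "p ^ d = 1"
    unfolding d_def by (rule power_diff_eq_one[OF nz(1)])
  then have dvd: "mult_ord p dvd d" using mult_ord_dvd_iff[of p d] nz by simp
  \<comment> \<open>This is the information from the power of \<open>X21\<close>. With
    \<open>p ^ d = 1\<close> it yields a divisibility for the order of \<beta>, the very quantity
    that the definition of \<open>l1\<close> tests.\<close>
  have "\<alpha> ^ (d * L2) = 1"
    unfolding d_def diff_mult_distrib by (rule power_diff_eq_one[OF alpha_nz X21_pow[symmetric]])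
  moreover have "p ^ (d * L2) = 1" by (rule power_eq_one_mult) fact
  ultimately have "\<beta> ^ (d * L2) = 1" by (simp add: power_mult_distrib)
  then have dvd': "mult_ord \<beta> dvd d * L2" using mult_ord_dvd_iff[OF beta_nz] by simp
  have "d < L1" using assms(2) by (simp add: d_def)
  have "d = 0"
  proof (rule ccontr)
    assume "d \<noteq> 0"
    obtain k where k: "d = mult_ord p * k" using dvd by (rule dvdE)
    have "k \<noteq> 0" using k \<open>d \<noteq> 0\<close> by auto
    show False
    \<comment> \<open>Without doubling, a nonzero multiple of \<open>mult_ord p\<close> is already
      too large for \<open>d < L1\<close>. With doubling only \<open>d = mult_ord p\<close> remains,
      and \<open>dvd'\<close> then contradicts the case assumption.\<close>
    proof (cases "mult_ord \<beta> dvd mult_ord p * L2")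
      case True
      then show False using \<open>d < L1\<close> k \<open>k \<noteq> 0\<close> by (simp add: l1_def l2_def)
    next
      case False
      then have "mult_ord p * k < mult_ord p * 2" using \<open>d < L1\<close> k by (simp add: l1_def l2_def)
      then have "k = 1" using \<open>k \<noteq> 0\<close> by simp
      then show False using dvd' k False by simp
    qed
  qed
  then show ?thesis using b assms(1) by (simp add: d_def)
qed

section \<open>Submodules and simplicity\<close>

lemma e_in_V: "a < L1 \<Longrightarrow> b < L2 \<Longrightarrow> e a b \<in> V"
  by (auto simp: V_def e_def split: if_splits)

text \<open>Puts eigenvalue equations on the basis into the coordinate form that
  \<open>single_mem_of_separating_diagonal\<close> expects.\<close>

lemma lookup_act_diagonal:
  assumes "\<And>a b. a < L1 \<Longrightarrow> b < L2 \<Longrightarrow> act (e a b) y = vscale (f (a, b)) (e a b)" "v \<in> V"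
  shows "Poly_Mapping.lookup (act v y) z = f z * Poly_Mapping.lookup v z"
proof -
  have "act (Poly_Mapping.single x 1) y = vscale (f x) (Poly_Mapping.single x 1)"
    if "x \<in> Poly_Mapping.keys v" for x
    using that assms unfolding V_def e_def by (cases x) blast
  then have "act v y = lin_ext (\<lambda>x. vscale (f x) (Poly_Mapping.single x 1)) v"
    unfolding act_eq_lin_ext[of v y] lin_ext_def by (intro sum.cong) simp_all
  also have "Poly_Mapping.lookup \<dots> z = f z * Poly_Mapping.lookup v z"
    by (induction v rule: poly_mapping_add_induct)
      (simp_all add: lin_ext_add lookup_add lookup_vscale lookup_single when_def distrib_left)
  finally show ?thesis .
qed

text \<open>The exponent \<open>0\<close> is set apart because \<open>b\<close> may exceed
  \<open>L2\<close>, and the empty product does not reduce it. For \<open>n = L2\<close> and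
  \<open>b < L2\<close> the shift returns to \<open>b\<close>, which gives the third diagonal
  operator.\<close>

lemma act_X21_power:
  "act (e a b) (gvar X21 ^ n) = vscale ((\<mu>2 * \<alpha> ^ a) ^ n) (e a (if n = 0 then b else (b + n) mod L2))"
proof (induction n)
  case 0
  then show ?case by (simp add: act_one)
next
  case (Suc n)
  then show ?case
    by (simp only: power_Suc2 act_mult) (simp add: act_gvar gact_basis mod_Suc_eq mult_ac)
qed

text \<open>\<open>right_submodule\<close> speaks only of addition and the ring action; closure
  under \<K>-scalars comes from the classes of \<open>scalar c\<close>.\<close>

lemma submodule_closed:
  assumes "right_submodule N R M"
  shows "N \<subseteq> V" and "0 \<in> N"
    and "v \<in> N \<Longrightarrow> w \<in> N \<Longrightarrow> v + w \<in> N"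
    and "v \<in> N \<Longrightarrow> act v x \<in> N"
    and "v \<in> N \<Longrightarrow> vscale c v \<in> N"
    and "v \<in> N \<Longrightarrow> w \<in> N \<Longrightarrow> v - w \<in> N"
proof -
  have N: "additive_subgroup N M" and act_closed: "\<And>v r. v \<in> N \<Longrightarrow> r \<in> carrier R \<Longrightarrow> v \<cdot>\<^bsub>M\<^esub> r \<in> N"
    using assms by (auto simp: right_submodule_def)
  show sub: "N \<subseteq> V" and "0 \<in> N"
    using additive_subgroup.a_subset[OF N] additive_subgroup.zero_closed[OF N] by simp_all
  show add: "v + w \<in> N" if "v \<in> N" "w \<in> N" for v w
    using additive_subgroup.a_closed[OF N that] by simp
  show act: "act v x \<in> N" if "v \<in> N" for v x
    using act_closed[OF that, of "cl x"] ract_cl[of v x] that sub carrier_R by auto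
  show scale: "vscale c v \<in> N" if "v \<in> N" for c v
    using act[OF that, of "scalar c"] by (simp only: act_scalar)
  show "v - w \<in> N" if "v \<in> N" "w \<in> N" for v w
    using add[OF that(1) scale[OF that(2), of "-1"]] by simp
qed

lemma submodule_contains_basis_vector:
  assumes N: "right_submodule N R M" and "v \<in> N" "v \<noteq> 0"
  shows "\<exists>a<L1. \<exists>b<L2. e a b \<in> N"
proof -
  note N_closed = submodule_closed[OF N]
  define f1 where "f1 = (\<lambda>(a, b). \<mu>3 * inverse \<alpha> * q ^ b * (p ^ Suc a - 1))"
  define f2 where "f2 = (\<lambda>(a, b). \<mu>3 * p ^ a * q ^ b)"
  define f3 where "f3 = (\<lambda>(a, b :: nat). (\<mu>2 * \<alpha> ^ a) ^ L2)"
  let ?T1 = "\<lambda>v. act v (gvar X22 * gvar X11)"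
  let ?T2 = "\<lambda>v. act v (gvar X12 * gvar X21)"
  let ?T3 = "\<lambda>v. act v (gvar X21 ^ L2)"
  have T1: "Poly_Mapping.lookup (?T1 v) z = f1 z * Poly_Mapping.lookup v z" if "v \<in> N" for v z
    by (rule lookup_act_diagonal)
      (use that N_closed(1) gact_X22_X11 in \<open>auto simp: act_mult_gvar f1_def simp del: power_Suc\<close>)
  have T2: "Poly_Mapping.lookup (?T2 v) z = f2 z * Poly_Mapping.lookup v z" if "v \<in> N" for v z
    by (rule lookup_act_diagonal)
      (use that N_closed(1) gact_X12_X21 in \<open>auto simp: act_mult_gvar f2_def\<close>)
  have T3: "Poly_Mapping.lookup (?T3 v) z = f3 z * Poly_Mapping.lookup v z" if "v \<in> N" for v z
    by (rule lookup_act_diagonal)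
      (use that N_closed(1) L2_pos in \<open>auto simp: act_X21_power f3_def\<close>)
  have inj: "(a, b) = (a', b')"
    if "a < L1" "b < L2" "a' < L1" "b' < L2"
      "f1 (a, b) = f1 (a', b')" "f2 (a, b) = f2 (a', b')" "f3 (a, b) = f3 (a', b')" for a b a' b'
  proof -
    have 1: "q ^ b * (p ^ Suc a - 1) = q ^ b' * (p ^ Suc a' - 1)"
      using that(5) mu_nz alpha_nz by (simp add: f1_def mult.assoc del: power_Suc)
    have 2: "p ^ a * q ^ b = p ^ a' * q ^ b'"
      using that(6) mu_nz by (simp add: f2_def mult.assoc)
    have 3: "\<alpha> ^ (a * L2) = \<alpha> ^ (a' * L2)"
      using that(7) mu_nz by (simp add: f3_def power_mult_distrib power_mult)
    \<comment> \<open>\<open>weights_separate\<close> assumes its first indices in order, so the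
      opposite order is covered by exchanging the two pairs.\<close>
    show ?thesis
      using weights_separate[OF _ that(3,2,4) 1 2 3]
        weights_separate[OF _ that(1,4,2) 1[symmetric] 2[symmetric] 3[symmetric]]
      by (cases "a \<le> a'") auto
  qed
  have "\<exists>x\<in>{..<L1} \<times> {..<L2}. Poly_Mapping.single x 1 \<in> N"
  proof (rule single_mem_of_separating_diagonal[OF _ _ _ _ assms(2,3)])
    fix x y assume "x \<in> {..<L1} \<times> {..<L2}" "y \<in> {..<L1} \<times> {..<L2}" "x \<noteq> y"
    then consider "f1 x \<noteq> f1 y" | "f2 x \<noteq> f2 y" | "f3 x \<noteq> f3 y"
      using inj by (cases x; cases y) blast
    then show "\<exists>f T. f x \<noteq> f y \<and>
      (\<forall>v\<in>N. T v \<in> N \<and> (\<forall>z. Poly_Mapping.lookup (T v) z = f z * Poly_Mapping.lookup v z))"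
    proof cases
      case 1
      then show ?thesis using T1 N_closed(4) by (intro exI[of _ f1] exI[of _ ?T1]) simp
    next
      case 2
      then show ?thesis using T2 N_closed(4) by (intro exI[of _ f2] exI[of _ ?T2]) simp
    next
      case 3
      then show ?thesis using T3 N_closed(4) by (intro exI[of _ f3] exI[of _ ?T3]) simp
    qed
  qed (use N_closed in \<open>auto simp: V_def\<close>)
  then show ?thesis by (auto simp: e_def)
qed

lemma submodule_contains_all_basis_vectors:
  assumes N: "right_submodule N R M" and "e a b \<in> N" "a < L1" "b < L2" "a' < L1" "b' < L2"
  shows "e a' b' \<in> N"
proof -
  note N_closed = submodule_closed[OF N]
  have unscale: "v \<in> N" if "vscale c v \<in> N" "c \<noteq> 0" for c v
    using N_closed(5)[OF that(1), of "inverse c"] that(2) by simp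
  have gact: "gact g v \<in> N" if "v \<in> N" for g v
    using N_closed(4)[OF that, of "gvar g"] by (simp only: act_gvar)
  have "e ((a + n) mod L1) b \<in> N" for n
  proof (induction n)
    case (Suc n)
    have "(a + n) mod L1 < L1" using L1_gt_1 by simp
    with unscale[OF gact[OF Suc, of X22, unfolded gact_X22_e[OF this]]] show ?case
      using mu_nz alpha_nz by (simp add: mod_Suc_eq split: if_splits)
  qed (use assms in simp)
  \<comment> \<open>This many cyclic steps lead from \<open>a\<close> to \<open>a' + L1\<close>,
    that is, to \<open>a'\<close>; adding \<open>L1\<close> avoids a negative shift. The second
    index is treated alike with \<open>X21\<close>.\<close>
  from this[of "a' + (L1 - a)"] have a': "e a' b \<in> N" using assms by simp
  have "e a' ((b + n) mod L2) \<in> N" for n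
  proof (induction n)
    case (Suc n)
    with unscale[OF gact[OF Suc, of X21, unfolded gact_e V2_gen.simps]] show ?case
      using mu_nz alpha_nz by (simp add: mod_Suc_eq)
  qed (use a' assms in simp)
  from this[of "b' + (L2 - b)"] show ?thesis using assms by simp
qed

lemma simple_M: "simple_right_module R M"
proof (intro simple_right_module.intro simple_right_module_axioms.intro right_module_M)
  have "Poly_Mapping.lookup (e 0 0) (0, 0) = (1 :: 'k)"
    by (simp add: e_def)
  then have "e 0 0 \<noteq> (0 :: 'k vec)" by auto
  moreover have "e 0 0 \<in> V" using e_in_V[of 0 0] L1_gt_1 L2_pos by simp
  ultimately show "carrier M \<noteq> {\<zero>\<^bsub>M\<^esub>}" by auto
  fix N assume N: "right_submodule N R M"
  note N_closed = submodule_closed[OF N]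
  show "N = {\<zero>\<^bsub>M\<^esub>} \<or> N = carrier M"
  proof (cases "N = {0}")
    case False
    then obtain v where "v \<in> N" "v \<noteq> 0" using N_closed(2) by blast
    then obtain a b where ab: "a < L1" "b < L2" "e a b \<in> N"
      using submodule_contains_basis_vector[OF N] by blast
    have "v \<in> N" if "v \<in> V" for v
    proof -
      have "vscale (Poly_Mapping.lookup v x) (Poly_Mapping.single x 1) \<in> N"
        if x: "x \<in> Poly_Mapping.keys v" for x
      proof -
        obtain a' b' where "x = (a', b')" "a' < L1" "b' < L2"
          using x \<open>v \<in> V\<close> by (cases x) (auto simp: V_def)
        then have "Poly_Mapping.single x 1 \<in> N"
          using submodule_contains_all_basis_vectors[OF N ab(3,1,2)] by (simp add: e_def)
        then show ?thesis by (rule N_closed(5))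
      qed
      then have "lin_ext (\<lambda>x. Poly_Mapping.single x 1) v \<in> N"
        unfolding lin_ext_def using N_closed(2,3) by (intro sum_mem) auto
      then show ?thesis by (simp only: lin_ext_single_one)
    qed
    then show ?thesis using N_closed(1) by auto
  qed simp
qed

end

section \<open>Simplicity, prescribed action and dimension\<close>

theorem theorem5p2:
  fixes \<alpha> \<beta> \<mu>1 \<mu>2 \<mu>3 :: "'k::alg_closed_field"
  assumes "\<alpha> \<noteq> 0" and "\<beta> \<noteq> 0"
    and "\<exists>n>0. \<alpha> ^ n = 1" and "\<exists>n>0. \<beta> ^ n = 1"
    and "\<alpha> * \<beta> \<noteq> 1"
    and "\<mu>1 \<noteq> 0" and "\<mu>2 \<noteq> 0" and "\<mu>3 \<noteq> 0"
  shows "simple_right_module (M2 \<alpha> \<beta>) (V2 \<alpha> \<beta> \<mu>1 \<mu>2 \<mu>3) \<and>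
    (\<forall>a<l1 \<alpha> \<beta>. \<forall>b<l2 \<alpha> \<beta>. \<forall>g.
       e a b \<cdot>\<^bsub>V2 \<alpha> \<beta> \<mu>1 \<mu>2 \<mu>3\<^esub> M2_class \<alpha> \<beta> (gvar g) = V2_gen \<alpha> \<beta> \<mu>1 \<mu>2 \<mu>3 g (a, b)) \<and>
    (\<forall>v\<in>carrier (V2 \<alpha> \<beta> \<mu>1 \<mu>2 \<mu>3). \<forall>c.
       v \<cdot>\<^bsub>V2 \<alpha> \<beta> \<mu>1 \<mu>2 \<mu>3\<^esub> M2_class \<alpha> \<beta> (scalar c) = vscale c v) \<and>
    vector_space.dim vscale (carrier (V2 \<alpha> \<beta> \<mu>1 \<mu>2 \<mu>3)) = l1 \<alpha> \<beta> * l2 \<alpha> \<beta>"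
proof -
  interpret V2_roots \<alpha> \<beta> \<mu>1 \<mu>2 \<mu>3
    by unfold_locales (fact assms)+
  have "e a b \<cdot>\<^bsub>M\<^esub> cl (gvar g) = V2_gen \<alpha> \<beta> \<mu>1 \<mu>2 \<mu>3 g (a, b)" if "a < L1" "b < L2" for a b g
    by (simp only: ract_cl[OF e_in_V[OF that]] act_gvar gact_e)
  moreover have "v \<cdot>\<^bsub>M\<^esub> cl (scalar c) = vscale c v" if "v \<in> carrier M" for v c
    using that ract_cl[of v] by (simp add: act_scalar)
  moreover have "vs.dim (carrier M) = L1 * L2"
    using dim_vec_space[of "{..<L1} \<times> {..<L2}"] by (simp add: V_def)
  ultimately show ?thesis using simple_M by blast
qed

end
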